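(* Let $\mathbf T\in\mathbb R^{[d,n]}$ be a nonzero, entrywise nonnegative, symmetric tensor and let $p>d$. Then, for any $\sigma\ge0$ and any entrywise positive $\mathbf x_0\in\mathbb R^n$, the sequence $(\lambda_k)$ generated by either Algorithm 1 or Algorithm 2 (run without stopping) converges to $r_p(\mathbf T)$.
   Context: $\mathbb R^{[d,n]}$ is the set of real tensors $\mathbf T=(t_{i_1,\dots,i_d})$ with $d$ modes ($d\ge2$) each of dimension $n$; $\mathbf T$ is symmetric if its entries are invariant under all permutations of the indices. Associated map $T:\mathbb R^n\to\mathbb R^n$, $T(\mathbf x)_{i_1}=\sum_{i_2,\dots,i_d}t_{i_1,i_2,\dots,i_d}x_{i_2}\cdots x_{i_d}$. For $1<p<\infty$, $\|\mathbf x\|_p=(\sum_i|x_i|^p)^{1/p}$ and $\Phi_p(\mathbf x)_i=\operatorname{sign}(x_i)|x_i|^{p-1}$. A real $\lambda$ is an $\ell^p$-eigenvalue of $\mathbf T$ with $\ell^p$-eigenvector $\mathbf x\in\mathbb R^n$ if $T(\mathbf x)=\lambda\Phi_p(\mathbf x)$ and $\|\mathbf x\|_p=1$. The $\ell^p$-spectral radius is $r_p(\mathbf T)=\sup\{|\lambda|:\lambda\text{ is an }\ell^p\text{-eigenvalue of }\mathbf T\}$. Let $f_p(\mathbf x)=\mathbf x^TT(\mathbf x)/\|\mathbf x\|_p^d$ for $\mathbf x\neq0$. Algorithms: let $q=p/(p-1)$, $\sigma\ge0$, $\mathbf x_0>0$. For $k=0,1,2,\dots$ put $\mathbf z=T(\mathbf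 x_k)$ and then compute $\mathbf y$ by Algorithm 1: $\mathbf y=\Phi_q(\mathbf z)+\sigma\,\operatorname{sign}(\mathbf z)\circ\mathbf x_k$; Algorithm 2: $\mathbf y=\Phi_q\big(\mathbf z+\sigma\,\operatorname{sign}(\mathbf z)\circ\Phi_p(\mathbf x_k)\big)$; and in both cases set $\mathbf x_{k+1}=\mathbf y/\|\mathbf y\|_p$, $\lambda_{k+1}=f_p(\mathbf x_{k+1})$. Here $\circ$ is the entrywise product and $\operatorname{sign}$ acts entrywise with $\operatorname{sign}(0)=0$. *)

theory Defs
  imports "HOL-Analysis.Analysis" "HOL-Combinatorics.Permutations"
begin

text \<open>A tensor with \<open>d\<close> modes, each indexed by \<open>'n\<close>, is given by its entries on the index lists of
  length \<open>d\<close>; its values on lists of any other length are irrelevant.\<close>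

type_synonym 'n tensor = "'n list \<Rightarrow> real"

definition tensor_symmetric :: "nat \<Rightarrow> 'n tensor \<Rightarrow> bool" where
  "tensor_symmetric d T \<longleftrightarrow>
     (\<forall>\<pi> is. \<pi> permutes {..<d} \<longrightarrow> length is = d \<longrightarrow> T (permute_list \<pi> is) = T is)"

definition tensor_nonneg :: "nat \<Rightarrow> 'n tensor \<Rightarrow> bool" where
  "tensor_nonneg d T \<longleftrightarrow> (\<forall>is. length is = d \<longrightarrow> T is \<ge> 0)"

definition tensor_nonzero :: "nat \<Rightarrow> 'n tensor \<Rightarrow> bool" where
  "tensor_nonzero d T \<longleftrightarrow> (\<exists>is. length is = d \<and> T is \<noteq> 0)"

definition tensor_map :: "nat \<Rightarrow> ('n::finite) tensor \<Rightarrow> real^'n \<Rightarrow> real^'n" where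
  "tensor_map d T x =
     (\<chi> i. \<Sum>js | length js = d - 1. T (i # js) * (\<Prod>j\<leftarrow>js. x $ j))"

definition lp_norm :: "real \<Rightarrow> real^('n::finite) \<Rightarrow> real" where
  "lp_norm p x = (\<Sum>i\<in>UNIV. \<bar>x $ i\<bar> powr p) powr (1 / p)"

definition duality_map :: "real \<Rightarrow> real^('n::finite) \<Rightarrow> real^'n" where
  "duality_map p x = (\<chi> i. sgn (x $ i) * \<bar>x $ i\<bar> powr (p - 1))"

text \<open>On vectors the library's \<^const>\<open>sgn\<close> is normalization by the Euclidean norm, hence
  the separate entrywise sign.  Multiplication on \<open>real^'n\<close> is the entrywise product.\<close>

definition entrywise_sign :: "real^('n::finite) \<Rightarrow> real^'n" where
  "entrywise_sign x = (\<chi> i. sgn (x $ i))"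

definition lp_eigenpair :: "nat \<Rightarrow> ('n::finite) tensor \<Rightarrow> real \<Rightarrow> real \<Rightarrow> real^'n \<Rightarrow> bool" where
  "lp_eigenpair d T p \<mu> x \<longleftrightarrow>
     tensor_map d T x = \<mu> *\<^sub>R duality_map p x \<and> lp_norm p x = 1"

definition lp_eigenvalue :: "nat \<Rightarrow> ('n::finite) tensor \<Rightarrow> real \<Rightarrow> real \<Rightarrow> bool" where
  "lp_eigenvalue d T p \<mu> \<longleftrightarrow> (\<exists>x. lp_eigenpair d T p \<mu> x)"

definition lp_spectral_radius :: "nat \<Rightarrow> ('n::finite) tensor \<Rightarrow> real \<Rightarrow> real" where
  "lp_spectral_radius d T p = Sup {\<bar>\<mu>\<bar> | \<mu>. lp_eigenvalue d T p \<mu>}"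

definition rayleigh :: "nat \<Rightarrow> ('n::finite) tensor \<Rightarrow> real \<Rightarrow> real^'n \<Rightarrow> real" where
  "rayleigh d T p x = (x \<bullet> tensor_map d T x) / lp_norm p x ^ d"

definition lp_normalize :: "real \<Rightarrow> real^('n::finite) \<Rightarrow> real^'n" where
  "lp_normalize p y = y /\<^sub>R lp_norm p y"

definition alg1_step :: "nat \<Rightarrow> ('n::finite) tensor \<Rightarrow> real \<Rightarrow> real \<Rightarrow> real^'n \<Rightarrow> real^'n" where
  "alg1_step d T p \<sigma> x =
     (let q = p / (p - 1);
          z = tensor_map d T x;
          y = duality_map q z + \<sigma> *\<^sub>R (entrywise_sign z * x)
      in lp_normalize p y)"

definition alg2_step :: "nat \<Rightarrow> ('n::finite) tensor \<Rightarrow> real \<Rightarrow> real \<Rightarrow> real^'n \<Rightarrow> real^'n" where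
  "alg2_step d T p \<sigma> x =
     (let q = p / (p - 1);
          z = tensor_map d T x;
          y = duality_map q (z + \<sigma> *\<^sub>R (entrywise_sign z * duality_map p x))
      in lp_normalize p y)"

definition alg1_iterate ::
    "nat \<Rightarrow> ('n::finite) tensor \<Rightarrow> real \<Rightarrow> real \<Rightarrow> real^'n \<Rightarrow> nat \<Rightarrow> real^'n" where
  "alg1_iterate d T p \<sigma> x0 k = (alg1_step d T p \<sigma> ^^ k) x0"

definition alg2_iterate ::
    "nat \<Rightarrow> ('n::finite) tensor \<Rightarrow> real \<Rightarrow> real \<Rightarrow> real^'n \<Rightarrow> nat \<Rightarrow> real^'n" where
  "alg2_iterate d T p \<sigma> x0 k = (alg2_step d T p \<sigma> ^^ k) x0"

end

theory Submission
  imports Defs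
begin

text \<open>
  Call an index active if it occurs in a nonzero entry of the tensor.  By symmetry all indices of
  a nonzero entry are active, so on the active coordinates \<open>T\<close> acts as an order-preserving map,
  homogeneous of degree \<open>d - 1\<close>, that sends positive vectors to positive vectors, while its
  inactive coordinates vanish.  Since \<open>d < p\<close>, the map \<open>F(x) = T(x)^(1/(p-1))\<close> (entrywise power)
  has degree \<open>a = (d-1)/(p-1) < 1\<close>, and everything follows from this strict inequality.

  Existence of an eigenpair: a large multiple of the indicator vector of the active set is mapped
  by \<open>F\<close> below itself and a small multiple above itself.  The iterates of \<open>F\<close> from the large
  multiple therefore decrease to a positive fixed point, and its normalization \<open>v\<close> is an
  eigenvector with an eigenvalue \<open>\<mu> > 0\<close> (\<open>fixed_point_exists\<close>, \<open>Perron_eigenpair_exists\<close>).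

  Maximality: for any eigenpair \<open>(\<nu>, x)\<close> with \<open>\<nu> \<noteq> 0\<close>, let \<open>M\<close> be the largest ratio \<open>\<bar>x\<^sub>i\<bar> / v\<^sub>i\<close>.
  Both vectors have norm one, so \<open>M \<ge> 1\<close>, and evaluating the eigenvalue equation where the ratio
  is attained gives \<open>\<bar>\<nu>\<bar> \<le> M^(d-p) \<mu> \<le> \<mu>\<close> (\<open>eigenvalue_bound\<close>).  Hence \<open>\<mu>\<close> is the spectral
  radius.

  Convergence: with \<open>s = 1\<close> for the first algorithm and \<open>s = p - 1\<close> for the second, both steps
  read, up to normalization, \<open>y^s = T(x)^(s/(p-1)) + \<sigma> x^s\<close>.  Let \<open>m\<close> and \<open>m R\<close> bound the ratios
  \<open>x\<^sub>i^s / v\<^sub>i^s\<close> from below and above.  Comparison with multiples of \<open>v\<close> bounds the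
  ratios of \<open>y\<close> by \<open>c m^a + \<sigma> m\<close> and \<open>c (m R)^a + \<sigma> m R\<close> with \<open>c = \<mu>^(s/(p-1))\<close>.  As the norms
  agree, \<open>m \<le> 1\<close>, and Bernoulli's inequality \<open>R^a \<le> 1 + a (R - 1)\<close> shows that \<open>R - 1\<close> shrinks
  by the fixed factor \<open>(c a + \<sigma>) / (c + \<sigma>) < 1\<close> in every step (\<open>damped_contraction\<close>,
  \<open>damped_step_contracts\<close>).  So the iterates converge to \<open>v\<close>, and their Rayleigh quotients to
  the one of \<open>v\<close>, which is \<open>\<mu>\<close>.
\<close>

section \<open>The tensor map and the p-norm\<close>

lemma finite_lists_of_length: "finite {js :: ('n::finite) list. length js = k}"
  using finite_lists_length_eq[of "UNIV :: 'n set" k] by simp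

lemma prod_list_mono_nonneg:
  fixes f g :: "'a \<Rightarrow> real"
  assumes "\<And>j. j \<in> set js \<Longrightarrow> 0 \<le> f j \<and> f j \<le> g j"
  shows "0 \<le> (\<Prod>j\<leftarrow>js. f j) \<and> (\<Prod>j\<leftarrow>js. f j) \<le> (\<Prod>j\<leftarrow>js. g j)"
  using assms
proof (induction js)
  case (Cons a js)
  from Cons.IH Cons.prems have "0 \<le> (\<Prod>j\<leftarrow>js. f j)" "(\<Prod>j\<leftarrow>js. f j) \<le> (\<Prod>j\<leftarrow>js. g j)"
    by auto
  moreover have "0 \<le> f a" "f a \<le> g a" using Cons.prems by auto
  ultimately show ?case by (auto intro!: mult_mono)
qed auto

lemma prod_list_scale:
  fixes f :: "'a \<Rightarrow> real"
  shows "(\<Prod>j\<leftarrow>js. t * f j) = t ^ length js * (\<Prod>j\<leftarrow>js. f j)"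
  by (induction js) auto

lemma prod_list_abs:
  fixes f :: "'a \<Rightarrow> real"
  shows "\<bar>(\<Prod>j\<leftarrow>js. f j)\<bar> = (\<Prod>j\<leftarrow>js. \<bar>f j\<bar>)"
  by (induction js) (auto simp: abs_mult)

lemma tendsto_prod_list:
  fixes f :: "'b \<Rightarrow> 'a \<Rightarrow> real"
  assumes "\<And>j. ((\<lambda>k. f k j) \<longlongrightarrow> l j) F"
  shows "((\<lambda>k. \<Prod>j\<leftarrow>js. f k j) \<longlongrightarrow> (\<Prod>j\<leftarrow>js. l j)) F"
  by (induction js) (auto intro!: tendsto_mult assms)

lemma tensor_map_scale: "tensor_map d T (t *\<^sub>R x) = t ^ (d - 1) *\<^sub>R tensor_map d T x"
  by (simp add: tensor_map_def vec_eq_iff prod_list_scale sum_distrib_left algebra_simps)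

lemma tendsto_tensor_map:
  assumes "(X \<longlongrightarrow> x) F"
  shows "((\<lambda>k. tensor_map d T (X k)) \<longlongrightarrow> tensor_map d T x) F"
  unfolding tensor_map_def
  by (intro tendsto_vec_lambda tendsto_sum tendsto_mult tendsto_const tendsto_prod_list
        tendsto_vec_nth assms)

lemma lp_norm_scale:
  assumes "p > 0"
  shows "lp_norm p (t *\<^sub>R x) = \<bar>t\<bar> * lp_norm p x"
proof -
  have "(\<Sum>i\<in>UNIV. \<bar>(t *\<^sub>R x) $ i\<bar> powr p) = \<bar>t\<bar> powr p * (\<Sum>i\<in>UNIV. \<bar>x $ i\<bar> powr p)"
    by (simp add: abs_mult powr_mult sum_distrib_left)
  then show ?thesis using assms
    by (simp add: lp_norm_def powr_mult powr_powr)
qed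

lemma lp_norm_mono:
  assumes "p > 0" "\<And>i. \<bar>x $ i\<bar> \<le> \<bar>y $ i\<bar>"
  shows "lp_norm p x \<le> lp_norm p y"
  unfolding lp_norm_def using assms
  by (intro powr_mono2 sum_mono sum_nonneg) auto

lemma lp_norm_pos:
  assumes "x $ i \<noteq> 0"
  shows "lp_norm p x > 0"
proof -
  have "0 < \<bar>x $ i\<bar> powr p" using assms by simp
  also have "\<dots> \<le> (\<Sum>i\<in>UNIV. \<bar>x $ i\<bar> powr p)"
    by (rule member_le_sum) auto
  finally show ?thesis by (simp add: lp_norm_def)
qed

lemma lp_norm_eq_1_iff:
  assumes "p > 0"
  shows "lp_norm p x = 1 \<longleftrightarrow> (\<Sum>i\<in>UNIV. \<bar>x $ i\<bar> powr p) = 1"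
proof
  assume *: "lp_norm p x = 1"
  let ?s = "\<Sum>i\<in>UNIV. \<bar>x $ i\<bar> powr p"
  have "(?s powr (1 / p)) powr p = 1" using * by (simp add: lp_norm_def)
  moreover have "?s \<ge> 0" by (intro sum_nonneg) auto
  ultimately show "?s = 1" using assms by (simp add: powr_powr)
qed (simp add: lp_norm_def)

lemma lp_norm_normalize:
  assumes "p > 0" "y $ i \<noteq> 0"
  shows "lp_norm p (lp_normalize p y) = 1"
  using lp_norm_pos[of y i p] assms
  by (simp add: lp_normalize_def lp_norm_scale)

section \<open>The scalar contraction\<close>

lemma powr_le_Bernoulli:
  fixes R a :: real
  assumes "R \<ge> 1" "0 \<le> a" "a \<le> 1"
  shows "R powr a \<le> 1 + a * (R - 1)"
proof -
  have "R powr a = R powr a * 1 powr (1 - a)" by simp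
  also have "\<dots> \<le> a * R + (1 - a) * 1"
    using assms by (intro Youngs_inequality_0) auto
  finally show ?thesis by (simp add: algebra_simps)
qed

text \<open>The ratio of the upper to the lower bound on the coordinates after one damped step.  Linearizing
  \<open>R^a\<close> leaves a weighted mean of the contraction factors \<open>a\<close> (weight \<open>c m^a\<close>) and \<open>1\<close>
  (weight \<open>\<sigma> m\<close>).  For \<open>m \<le> 1\<close> we have \<open>m^a \<ge> m\<close>, so the worst case of that mean is \<open>m = 1\<close>,
  which makes the rate independent of \<open>m\<close>.\<close>

lemma damped_contraction:
  fixes c \<sigma> a m R :: real
  assumes "c > 0" "\<sigma> \<ge> 0" "0 \<le> a" "a \<le> 1" "0 < m" "m \<le> 1" "1 \<le> R"
  shows "c * (m * R) powr a + \<sigma> * (m * R)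
       \<le> (c * m powr a + \<sigma> * m) * (1 + (c * a + \<sigma>) / (c + \<sigma>) * (R - 1))"
proof -
  define A where "A = m powr a"
  have "A \<ge> m" using powr_mono'[of a 1 m] assms by (simp add: A_def)
  have "A > 0" using assms by (simp add: A_def)
  have "(c * A + \<sigma> * m) * (c * a + \<sigma>) - (c * a * A + \<sigma> * m) * (c + \<sigma>)
      = (1 - a) * (c * (\<sigma> * (A - m)))"
    by (simp add: algebra_simps)
  moreover have "\<dots> \<ge> 0" using assms \<open>A \<ge> m\<close> by simp
  ultimately have le: "c * a * A + \<sigma> * m \<le> (c * A + \<sigma> * m) * ((c * a + \<sigma>) / (c + \<sigma>))"
    using assms by (simp add: pos_le_divide_eq)
  have "c * (m * R) powr a + \<sigma> * (m * R) = c * A * R powr a + \<sigma> * m * R"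
    using assms by (simp add: A_def powr_mult)
  also have "\<dots> \<le> c * A * (1 + a * (R - 1)) + \<sigma> * m * R"
    using assms \<open>A > 0\<close> by (intro add_right_mono mult_left_mono powr_le_Bernoulli) auto
  also have "\<dots> = (c * A + \<sigma> * m) + (c * a * A + \<sigma> * m) * (R - 1)"
    by (simp add: algebra_simps)
  also have "\<dots> \<le> (c * A + \<sigma> * m) + (c * A + \<sigma> * m) * ((c * a + \<sigma>) / (c + \<sigma>)) * (R - 1)"
    using le assms by (intro add_left_mono mult_right_mono) auto
  finally show ?thesis by (simp add: A_def algebra_simps)
qed

section \<open>Order properties on the active coordinates\<close>

locale nonneg_symmetric_tensor =
  fixes T :: "('n::finite) tensor" and d :: nat and p :: real
  assumes two_le_d: "d \<ge> 2"
    and nonzero: "tensor_nonzero d T"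
    and nonneg: "tensor_nonneg d T"
    and symmetric: "tensor_symmetric d T"
    and d_less_p: "p > real d"
begin

text \<open>Symmetry makes the first position as good as any other.\<close>

definition active :: "'n set" where
  "active = {i. \<exists>js. length js = d - 1 \<and> T (i # js) \<noteq> 0}"

definition positive :: "real^'n \<Rightarrow> bool" where
  "positive x \<longleftrightarrow> (\<forall>i\<in>active. x $ i > 0)"

text \<open>Every iterate after the starting vector has vanishing inactive coordinates.  Including this
  in the sphere lets vectors be compared through their active coordinates alone.\<close>

definition on_sphere :: "real^'n \<Rightarrow> bool" where
  "on_sphere x \<longleftrightarrow> (\<forall>i. i \<notin> active \<longrightarrow> x $ i = 0) \<and> lp_norm p x = 1"

lemma p_pos: "p > 2" "p > 1" "p > 0"
  using two_le_d d_less_p by auto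

lemma entry_nonneg: "length js = d - 1 \<Longrightarrow> T (i # js) \<ge> 0"
  using nonneg two_le_d by (auto simp: tensor_nonneg_def)

lemma active_nonempty: "active \<noteq> {}"
proof -
  obtain "is" where "length is = d" "T is \<noteq> 0"
    using nonzero by (auto simp: tensor_nonzero_def)
  with two_le_d have "hd is \<in> active"
    by (cases "is") (auto simp: active_def intro!: exI[of _ "tl is"])
  then show ?thesis by blast
qed

text \<open>A transposition moves the index \<open>j\<close> to the front of the entry.\<close>

lemma active_indices:
  assumes "length js = d - 1" "T (i # js) \<noteq> 0" "j \<in> set js"
  shows "j \<in> active"
proof -
  obtain k where k: "k < length js" "js ! k = j" using assms(3) by (auto simp: in_set_conv_nth)
  let ?\<pi> = "Transposition.transpose 0 (Suc k)"
  let ?l = "permute_list ?\<pi> (i # js)"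
  have len: "length (i # js) = d" using assms two_le_d by simp
  have perm: "?\<pi> permutes {..<d}"
    using k len by (intro permutes_swap_id) auto
  have "T ?l = T (i # js)"
    using symmetric perm len unfolding tensor_symmetric_def by blast
  moreover have "?l = j # tl ?l"
  proof -
    have "?l ! 0 = (i # js) ! ?\<pi> 0"
      using perm len two_le_d by (intro permute_list_nth) auto
    then have "?l ! 0 = j" using k by simp
    moreover have "?l \<noteq> []" using len by (metis length_permute_list list.size(3) length_0_conv list.distinct(1))
    ultimately show ?thesis by (cases ?l) auto
  qed
  moreover have "length (tl ?l) = d - 1" using len by simp
  ultimately show ?thesis using assms(2) unfolding active_def
    by (metis (mono_tags, lifting) mem_Collect_eq)
qed

lemma tensor_map_inactive: "i \<notin> active \<Longrightarrow> tensor_map d T x $ i = 0"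
  by (auto simp: tensor_map_def active_def intro!: sum.neutral)

text \<open>Only the active coordinates need to be compared, because inactive ones enter \<open>T\<close> with
  coefficient zero.\<close>

lemma tensor_map_mono:
  assumes "\<And>j. j \<in> active \<Longrightarrow> 0 \<le> x $ j \<and> x $ j \<le> y $ j"
  shows "tensor_map d T x $ i \<le> tensor_map d T y $ i"
  unfolding tensor_map_def vec_lambda_beta
proof (rule sum_mono)
  fix js :: "'n list" assume "js \<in> {js. length js = d - 1}"
  then have len: "length js = d - 1" by simp
  show "T (i # js) * (\<Prod>j\<leftarrow>js. x $ j) \<le> T (i # js) * (\<Prod>j\<leftarrow>js. y $ j)"
  proof (cases "T (i # js) = 0")
    case False
    have "(\<Prod>j\<leftarrow>js. x $ j) \<le> (\<Prod>j\<leftarrow>js. y $ j)"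
      using prod_list_mono_nonneg[of js "\<lambda>j. x $ j" "\<lambda>j. y $ j"] active_indices[OF len False] assms
      by blast
    then show ?thesis using entry_nonneg[OF len] by (intro mult_left_mono)
  qed simp
qed

lemma tensor_map_pos:
  assumes "positive x" "i \<in> active"
  shows "tensor_map d T x $ i > 0"
proof -
  have pos: "(\<Prod>j\<leftarrow>js. x $ j) > 0" if "length js = d - 1" "T (i # js) \<noteq> 0" for js :: "'n list"
  proof -
    have "\<forall>j\<in>set js. x $ j > 0" using active_indices[OF that] assms by (auto simp: positive_def)
    then show ?thesis by (induction js) auto
  qed
  obtain js where js: "length js = d - 1" "T (i # js) \<noteq> 0" using assms by (auto simp: active_def)
  have "0 \<le> T (i # js) * (\<Prod>j\<leftarrow>js. x $ j)" if "length js = d - 1" for js :: "'n list"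
    using pos[OF that] entry_nonneg[OF that, of i] by (cases "T (i # js) = 0") (auto simp: less_imp_le)
  moreover have "0 < T (i # js) * (\<Prod>j\<leftarrow>js. x $ j)"
    using pos[OF js] entry_nonneg[OF js(1), of i] js(2) by (auto intro!: mult_pos_pos)
  ultimately show ?thesis
    unfolding tensor_map_def vec_lambda_beta
    using js by (intro sum_pos2[of _ js] finite_lists_of_length) auto
qed

lemma tensor_map_abs: "\<bar>tensor_map d T x $ i\<bar> \<le> tensor_map d T (\<chi> j. \<bar>x $ j\<bar>) $ i"
proof -
  have "\<bar>tensor_map d T x $ i\<bar> \<le> (\<Sum>js | length js = d - 1. \<bar>T (i # js) * (\<Prod>j\<leftarrow>js. x $ j)\<bar>)"
    unfolding tensor_map_def vec_lambda_beta by (rule sum_abs)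
  also have "\<dots> = tensor_map d T (\<chi> j. \<bar>x $ j\<bar>) $ i"
    unfolding tensor_map_def vec_lambda_beta
    by (intro sum.cong refl) (auto simp: abs_mult prod_list_abs entry_nonneg)
  finally show ?thesis .
qed

text \<open>This is how the normalization of two vectors limits the factor between them.\<close>

lemma on_sphere_bound:
  assumes "on_sphere x" "on_sphere y" "t \<ge> 0" "\<And>i. i \<in> active \<Longrightarrow> t * \<bar>x $ i\<bar> \<le> \<bar>y $ i\<bar>"
  shows "t \<le> 1"
proof -
  have "\<bar>(t *\<^sub>R x) $ i\<bar> \<le> \<bar>y $ i\<bar>" for i
    using assms by (cases "i \<in> active") (auto simp: on_sphere_def abs_mult)
  then have "lp_norm p (t *\<^sub>R x) \<le> lp_norm p y" using p_pos by (intro lp_norm_mono) auto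
  then show ?thesis using assms p_pos by (auto simp: lp_norm_scale on_sphere_def)
qed

lemma power_d_powr:
  assumes "t > 0"
  shows "t ^ (d - 1) = t powr (real d - 1)"
  using assms two_le_d by (simp add: powr_realpow[symmetric] of_nat_diff)

section \<open>Existence of a positive eigenvector\<close>

text \<open>A constant vector \<open>r\<close> on the active set satisfies \<open>T(r u) = r^(d-1) T(u)\<close>, to be compared with
  \<open>r^(p-1)\<close>: as \<open>d < p\<close>, the latter wins for large \<open>r\<close> and loses for small \<open>r\<close>.  The resulting
  super- and subsolution enclose a decreasing sequence of iterates, whose limit stays positive.\<close>

lemma fixed_point_exists:
  obtains x where "\<And>i. i \<in> active \<Longrightarrow> x $ i > 0" "\<And>i. i \<notin> active \<Longrightarrow> x $ i = 0"
    "\<And>i. tensor_map d T x $ i = (x $ i) powr (p - 1)"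
proof -
  define u :: "real^'n" where "u = (\<chi> i. if i \<in> active then 1 else 0)"
  define F where "F x = (\<chi> i. (tensor_map d T x $ i) powr (1 / (p - 1)))" for x :: "real^'n"
  define B where "B = Max ((\<lambda>i. tensor_map d T u $ i) ` active)"
  define b where "b = Min ((\<lambda>i. tensor_map d T u $ i) ` active)"
  \<comment> \<open>Chosen such that \<open>t^(p-d)\<close> and \<open>s^(p-d)\<close> are the largest and smallest active entries of \<open>T(u)\<close>, so that
    \<open>t u\<close> and \<open>s u\<close> are a super- and a subsolution of \<open>F(x) = x\<close>.\<close>
  define t where "t = B powr (1 / (p - real d))"
  define s where "s = b powr (1 / (p - real d))"
  have upos: "tensor_map d T u $ i > 0" if "i \<in> active" for i
    using that by (intro tensor_map_pos) (auto simp: positive_def u_def)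
  have bB: "b \<le> tensor_map d T u $ i" "tensor_map d T u $ i \<le> B" if "i \<in> active" for i
    using that by (auto simp: b_def B_def)
  have b: "b > 0" using active_nonempty upos by (simp add: b_def)
  obtain i0 where i0: "i0 \<in> active" using active_nonempty by auto
  have B: "B > 0" "b \<le> B" using upos[OF i0] bB[OF i0] by auto
  have t: "t > 0" and s: "s > 0" using b B by (auto simp: t_def s_def)
  have st: "s \<le> t" using B b d_less_p by (auto simp: s_def t_def intro!: powr_mono2)
  have tB: "t powr (p - real d) = B" and sb: "s powr (p - real d) = b"
    using b B d_less_p by (auto simp: t_def s_def powr_powr)
  have key: "(r ^ (d - 1) * r powr (p - real d)) powr (1 / (p - 1)) = r" if "r > 0" for r :: real
  proof -
    have "r ^ (d - 1) * r powr (p - real d) = r powr (p - 1)"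
      using that by (simp add: power_d_powr[unfolded One_nat_def] flip: powr_add)
    then show ?thesis using that p_pos by (simp add: powr_powr)
  qed
  have upper: "F (t *\<^sub>R u) $ i \<le> t" and lower: "s \<le> F (s *\<^sub>R u) $ i" if "i \<in> active" for i
  proof -
    have "F (t *\<^sub>R u) $ i = (t ^ (d - 1) * tensor_map d T u $ i) powr (1 / (p - 1))"
      by (simp add: F_def tensor_map_scale)
    also have "\<dots> \<le> (t ^ (d - 1) * t powr (p - real d)) powr (1 / (p - 1))"
      using t bB(2)[OF that] upos[OF that] p_pos tB
      by (intro powr_mono2 mult_left_mono) auto
    finally show "F (t *\<^sub>R u) $ i \<le> t" using key[OF t] by simp
    have "s = (s ^ (d - 1) * s powr (p - real d)) powr (1 / (p - 1))"
      using key[OF s] by simp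
    also have "\<dots> \<le> (s ^ (d - 1) * tensor_map d T u $ i) powr (1 / (p - 1))"
      using s bB(1)[OF that] upos[OF that] p_pos sb
      by (intro powr_mono2 mult_left_mono) auto
    also have "\<dots> = F (s *\<^sub>R u) $ i"
      by (simp add: F_def tensor_map_scale)
    finally show "s \<le> F (s *\<^sub>R u) $ i" .
  qed
  have F_mono: "F x $ i \<le> F y $ i"
    if "\<And>j. j \<in> active \<Longrightarrow> 0 < x $ j \<and> x $ j \<le> y $ j" for x y :: "real^'n" and i
  proof (cases "i \<in> active")
    case True
    have "tensor_map d T x $ i > 0" using True that by (intro tensor_map_pos) (auto simp: positive_def)
    moreover have "tensor_map d T x $ i \<le> tensor_map d T y $ i"
      by (rule tensor_map_mono) (use that in \<open>auto simp: less_imp_le\<close>)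
    ultimately show ?thesis using p_pos by (auto simp: F_def intro!: powr_mono2)
  qed (simp add: F_def tensor_map_inactive)
  define X where "X k = (F ^^ k) (t *\<^sub>R u)" for k
  have X_Suc: "X (Suc k) = F (X k)" for k by (simp add: X_def)
  have u1: "u $ j = 1" if "j \<in> active" for j using that by (simp add: u_def)
  have lowerX: "s \<le> X k $ i" if "i \<in> active" for k i
    using that
  proof (induction k arbitrary: i)
    case 0 then show ?case using st by (simp add: X_def u1)
  next
    case (Suc k)
    have "s \<le> F (s *\<^sub>R u) $ i" by (rule lower[OF Suc.prems])
    also have "\<dots> \<le> F (X k) $ i" using Suc.IH s by (intro F_mono) (simp add: u1)
    finally show ?case by (simp add: X_Suc)
  qed
  have decX: "X (Suc k) $ i \<le> X k $ i" if "i \<in> active" for k i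
    using that
  proof (induction k arbitrary: i)
    case 0 then show ?case using upper by (simp add: X_def u1)
  next
    case (Suc k)
    have "0 < X (Suc k) $ j" if "j \<in> active" for j using lowerX[OF that, of "Suc k"] s by simp
    then have "F (X (Suc k)) $ i \<le> F (X k) $ i" using Suc.IH by (intro F_mono) blast
    then show ?case by (simp add: X_Suc)
  qed
  have zeroX: "X k $ i = 0" if "i \<notin> active" for k i
    using that by (cases k) (auto simp: X_def u_def F_def tensor_map_inactive)
  have "\<exists>l. (\<lambda>k. X k $ i) \<longlonglongrightarrow> l" for i
  proof (cases "i \<in> active")
    case True
    then have "decseq (\<lambda>k. X k $ i)" and "\<forall>k. s \<le> X k $ i"
      using decX lowerX by (simp_all add: decseq_Suc_iff)
    then obtain l where "(\<lambda>k. X k $ i) \<longlonglongrightarrow> l" by (rule decseq_convergent)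
    then show ?thesis ..
  next
    case False
    then show ?thesis by (intro exI[of _ 0]) (simp add: zeroX)
  qed
  then obtain l where l: "\<And>i. (\<lambda>k. X k $ i) \<longlonglongrightarrow> l i" by metis
  define x where "x = (\<chi> i. l i)"
  have Xx: "X \<longlonglongrightarrow> x" by (rule vec_tendstoI) (simp add: x_def l)
  have x_ge: "x $ i \<ge> s" if "i \<in> active" for i
    unfolding x_def vec_lambda_beta
    by (rule LIMSEQ_le_const[OF l]) (use lowerX[OF that] in blast)
  have x_zero: "x $ i = 0" if "i \<notin> active" for i
    using l[of i] zeroX[OF that] by (simp add: x_def LIMSEQ_const_iff)
  have x_pos: "x $ i > 0" if "i \<in> active" for i using x_ge[OF that] s by simp
  have fixed: "tensor_map d T x $ i = (x $ i) powr (p - 1)" for i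
  proof (cases "i \<in> active")
    case True
    have pos: "tensor_map d T x $ i > 0" using x_pos True by (intro tensor_map_pos) (auto simp: positive_def)
    have "(\<lambda>k. F (X k) $ i) \<longlonglongrightarrow> (tensor_map d T x $ i) powr (1 / (p - 1))"
      unfolding F_def vec_lambda_beta
      using pos by (intro tendsto_powr tendsto_vec_nth tendsto_tensor_map Xx tendsto_const) auto
    moreover have "(\<lambda>k. F (X k) $ i) \<longlonglongrightarrow> x $ i"
      using LIMSEQ_Suc[OF tendsto_vec_nth[OF Xx, of i]] by (simp add: X_Suc)
    ultimately have "x $ i = (tensor_map d T x $ i) powr (1 / (p - 1))"
      using LIMSEQ_unique by blast
    then show ?thesis using pos p_pos by (simp add: powr_powr)
  qed (simp add: tensor_map_inactive x_zero)
  show ?thesis by (rule that[OF x_pos x_zero fixed])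
qed

text \<open>The two sides of the fixed point equation have degrees \<open>d - 1\<close> and \<open>p - 1\<close>, so normalizing
  turns the factor \<open>1\<close> into the eigenvalue \<open>\<parallel>x\<parallel>^(p-d)\<close>.\<close>

lemma Perron_eigenpair_exists:
  obtains v \<mu> where "positive v" "on_sphere v" "\<mu> > 0"
    "\<And>i. tensor_map d T v $ i = \<mu> * (v $ i) powr (p - 1)"
proof -
  obtain x where x: "\<And>i. i \<in> active \<Longrightarrow> x $ i > 0" "\<And>i. i \<notin> active \<Longrightarrow> x $ i = 0"
    "\<And>i. tensor_map d T x $ i = (x $ i) powr (p - 1)" using fixed_point_exists by blast
  obtain i0 where i0: "i0 \<in> active" using active_nonempty by auto
  define N where "N = lp_norm p x"
  have N: "N > 0" using lp_norm_pos[of x i0] x(1)[OF i0] by (simp add: N_def)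
  have nonneg: "x $ i \<ge> 0" for i using x(1,2)[of i] by (cases "i \<in> active") auto
  show ?thesis
  proof (rule that[of "lp_normalize p x" "N powr (p - real d)"])
    show "positive (lp_normalize p x)" using x N by (auto simp: positive_def lp_normalize_def N_def)
    show "on_sphere (lp_normalize p x)"
      using lp_norm_normalize[of p x i0] x(1)[OF i0] x(2) p_pos
      by (auto simp: on_sphere_def lp_normalize_def)
    show "N powr (p - real d) > 0" using N by simp
    fix i
    have "tensor_map d T (lp_normalize p x) $ i = inverse N powr (real d - 1) * (x $ i) powr (p - 1)"
      using N by (simp add: lp_normalize_def N_def[symmetric] tensor_map_scale power_d_powr[unfolded One_nat_def] x(3)
          del: power_inverse)
    also have "inverse N powr (real d - 1) = N powr (p - real d) * inverse N powr (p - 1)"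
      using N by (simp add: powr_minus[symmetric] inverse_powr flip: powr_add)
    finally show "tensor_map d T (lp_normalize p x) $ i
        = N powr (p - real d) * (lp_normalize p x $ i) powr (p - 1)"
      using N nonneg[of i] by (simp add: lp_normalize_def N_def[symmetric] powr_mult)
  qed
qed

end

section \<open>The positive eigenvalue is the spectral radius\<close>

locale Perron_eigenpair = nonneg_symmetric_tensor T d p
  for T :: "('n::finite) tensor" and d :: nat and p :: real +
  fixes v :: "real^'n" and \<mu> :: real
  assumes v_positive: "positive v"
    and v_sphere: "on_sphere v"
    and \<mu>_pos: "\<mu> > 0"
    and v_eigen: "tensor_map d T v $ i = \<mu> * (v $ i) powr (p - 1)"
begin

lemma v_pos: "i \<in> active \<Longrightarrow> v $ i > 0"
  using v_positive by (simp add: positive_def)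

lemma v_zero: "i \<notin> active \<Longrightarrow> v $ i = 0"
  using v_sphere by (simp add: on_sphere_def)

lemma v_nonneg: "v $ i \<ge> 0"
  using v_pos v_zero by (cases "i \<in> active") (auto simp: less_imp_le)

text \<open>Let \<open>M\<close> be the largest ratio \<open>\<bar>x\<^sub>i\<bar> / v\<^sub>i\<close>.  Then \<open>\<bar>T(x)\<bar> \<le> T(M v) = M^(d-1) \<mu> v^(p-1)\<close>, and
  where the ratio is attained the left side is \<open>\<bar>\<nu>\<bar> M^(p-1) v\<^sub>i^(p-1)\<close>.  Because \<open>M \<ge> 1\<close> and
  \<open>d < p\<close>, the powers of \<open>M\<close> only help.\<close>

lemma eigenvalue_bound:
  assumes "lp_eigenpair d T p \<nu> x"
  shows "\<bar>\<nu>\<bar> \<le> \<mu>"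
proof (cases "\<nu> = 0")
  case False
  have eig: "tensor_map d T x $ i = \<nu> * (sgn (x $ i) * \<bar>x $ i\<bar> powr (p - 1))" for i
    using assms by (simp add: lp_eigenpair_def duality_map_def)
  \<comment> \<open>A nonzero eigenvalue forces the inactive coordinates to vanish; for \<open>\<nu> = 0\<close> they may be
    arbitrary, hence the case distinction.\<close>
  have x_zero: "x $ i = 0" if "i \<notin> active" for i
    using eig[of i] tensor_map_inactive[OF that, of x] False by (auto simp: sgn_if split: if_splits)
  have x_sphere: "on_sphere x" using assms x_zero by (auto simp: on_sphere_def lp_eigenpair_def)
  define M where "M = Max ((\<lambda>i. \<bar>x $ i\<bar> / v $ i) ` active)"
  have "M \<in> (\<lambda>i. \<bar>x $ i\<bar> / v $ i) ` active"
    unfolding M_def using active_nonempty by (intro Max_in) auto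
  then obtain i where i: "i \<in> active" "M = \<bar>x $ i\<bar> / v $ i" by blast
  have x_le: "\<bar>x $ j\<bar> \<le> M * v $ j" if "j \<in> active" for j
  proof -
    have "\<bar>x $ j\<bar> / v $ j \<le> M" using that by (simp add: M_def)
    then show ?thesis using v_pos[OF that] by (simp add: divide_le_eq)
  qed
  have "M \<ge> 1"
  proof (rule ccontr)
    assume "\<not> M \<ge> 1"
    have "M \<ge> 0" using i v_pos by (simp add: less_imp_le)
    have norm_le: "lp_norm p x \<le> lp_norm p (M *\<^sub>R v)"
    proof (rule lp_norm_mono)
      show "\<bar>x $ j\<bar> \<le> \<bar>(M *\<^sub>R v) $ j\<bar>" for j
      proof (cases "j \<in> active")
        case True
        then show ?thesis using x_le[OF True] v_pos[OF True] \<open>M \<ge> 0\<close> by (simp add: abs_mult)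
      qed (simp add: x_zero)
    qed (use p_pos in simp)
    have "lp_norm p (M *\<^sub>R v) = M"
      using v_sphere p_pos \<open>M \<ge> 0\<close> by (simp add: lp_norm_scale on_sphere_def)
    with norm_le show False using x_sphere \<open>\<not> M \<ge> 1\<close> by (simp add: on_sphere_def)
  qed
  have xi: "\<bar>x $ i\<bar> = M * v $ i" using i v_pos by (metis less_irrefl nonzero_eq_divide_eq)
  have "x $ i \<noteq> 0" using xi \<open>M \<ge> 1\<close> v_pos[OF i(1)] by auto
  have "\<bar>\<nu>\<bar> * (M * v $ i) powr (p - 1) = \<bar>tensor_map d T x $ i\<bar>"
    using \<open>x $ i \<noteq> 0\<close> by (simp add: eig abs_mult abs_sgn_eq xi)
  also have "\<dots> \<le> tensor_map d T (\<chi> j. \<bar>x $ j\<bar>) $ i" by (rule tensor_map_abs)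
  also have "\<dots> \<le> tensor_map d T (M *\<^sub>R v) $ i"
    using x_le by (intro tensor_map_mono) auto
  also have "\<dots> = M ^ (d - 1) * (\<mu> * (v $ i) powr (p - 1))"
    by (simp add: tensor_map_scale v_eigen)
  also have "\<dots> \<le> M powr (p - 1) * (\<mu> * (v $ i) powr (p - 1))"
    using \<open>M \<ge> 1\<close> d_less_p \<mu>_pos
    by (intro mult_right_mono) (auto simp: power_d_powr[unfolded One_nat_def] intro!: powr_mono)
  finally have "\<bar>\<nu>\<bar> * (M powr (p - 1) * (v $ i) powr (p - 1))
      \<le> \<mu> * (M powr (p - 1) * (v $ i) powr (p - 1))"
    using \<open>M \<ge> 1\<close> v_nonneg by (simp add: powr_mult mult.left_commute)
  moreover have "M powr (p - 1) * (v $ i) powr (p - 1) > 0"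
    using \<open>M \<ge> 1\<close> v_pos[OF i(1)] by simp
  ultimately show ?thesis by (simp add: mult_le_cancel_right)
qed (use \<mu>_pos in simp)

lemma spectral_radius_eq: "lp_spectral_radius d T p = \<mu>"
  unfolding lp_spectral_radius_def
proof (rule cSup_eq_maximum)
  have "tensor_map d T v = \<mu> *\<^sub>R duality_map p v"
    using v_nonneg by (auto simp: vec_eq_iff v_eigen duality_map_def sgn_if order.antisym)
  then have "lp_eigenpair d T p \<mu> v"
    using v_sphere by (simp add: lp_eigenpair_def on_sphere_def)
  then show "\<mu> \<in> {\<bar>\<mu>\<bar> |\<mu>. lp_eigenvalue d T p \<mu>}"
    using \<mu>_pos by (force simp: lp_eigenvalue_def)
qed (auto simp: lp_eigenvalue_def intro: eigenvalue_bound)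

lemma rayleigh_v: "rayleigh d T p v = \<mu>"
proof -
  have "v \<bullet> tensor_map d T v = (\<Sum>i\<in>UNIV. \<mu> * \<bar>v $ i\<bar> powr p)"
    unfolding inner_vec_def
  proof (intro sum.cong refl)
    fix i
    show "v $ i \<bullet> tensor_map d T v $ i = \<mu> * \<bar>v $ i\<bar> powr p"
    proof (cases "v $ i = 0")
      case False
      then have "v $ i > 0" using v_nonneg[of i] by simp
      then have "v $ i powr p = v $ i * v $ i powr (p - 1)" by (simp add: powr_diff)
      then show ?thesis using \<open>v $ i > 0\<close> by (simp add: v_eigen)
    qed simp
  qed
  also have "\<dots> = \<mu>"
    using v_sphere p_pos by (simp add: on_sphere_def lp_norm_eq_1_iff flip: sum_distrib_left)
  finally show ?thesis using v_sphere by (simp add: rayleigh_def on_sphere_def)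
qed

lemma rayleigh_tendsto:
  assumes "X \<longlonglongrightarrow> v" "\<And>k. on_sphere (X k)"
  shows "(\<lambda>k. rayleigh d T p (X k)) \<longlonglongrightarrow> \<mu>"
proof -
  have "(\<lambda>k. X k \<bullet> tensor_map d T (X k)) \<longlonglongrightarrow> v \<bullet> tensor_map d T v"
    by (intro tendsto_inner tendsto_tensor_map assms)
  moreover have "v \<bullet> tensor_map d T v = \<mu>"
    using rayleigh_v v_sphere by (simp add: rayleigh_def on_sphere_def)
  ultimately show ?thesis using assms(2) by (simp add: rayleigh_def on_sphere_def)
qed

section \<open>Contraction of damped steps\<close>

text \<open>Bounds on the spread of the ratios of \<open>x\<close> to \<open>v\<close>; up to the power \<open>s\<close>, the smallest such \<open>R\<close>
  is the exponential of Hilbert's projective distance between \<open>x\<close> and \<open>v\<close>.  The factor \<open>m\<close>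
  absorbs the normalization constants of the steps.\<close>

definition proportional_within :: "real \<Rightarrow> real \<Rightarrow> real^'n \<Rightarrow> bool" where
  "proportional_within s R x \<longleftrightarrow> (\<exists>m>0. \<forall>i\<in>active. m * (v $ i) powr s \<le> (x $ i) powr s \<and>
                                      (x $ i) powr s \<le> m * R * (v $ i) powr s)"

text \<open>The common form of both algorithms: the damping term is added to the \<open>s\<close>-th powers, with
  \<open>s = 1\<close> in the first and \<open>s = p - 1\<close> in the second.  The scalar \<open>\<kappa>\<close> stands for the normalization.\<close>

definition damped_step :: "real \<Rightarrow> real \<Rightarrow> real^'n \<Rightarrow> real^'n \<Rightarrow> bool" where
  "damped_step s \<sigma> x y \<longleftrightarrow> positive y \<and> on_sphere y \<and>
     (\<exists>\<kappa>>0. \<forall>i\<in>active. (y $ i) powr s =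
        \<kappa> * ((tensor_map d T x $ i) powr (s / (p - 1)) + \<sigma> * (x $ i) powr s))"

lemma proportional_within_exists:
  assumes "positive x"
  obtains R where "R \<ge> 1" "proportional_within s R x"
proof -
  define r where "r i = (x $ i) powr s / (v $ i) powr s" for i
  define m where "m = Min (r ` active)"
  define M where "M = Max (r ` active)"
  have rpos: "r i > 0" if "i \<in> active" for i
    using that assms v_pos[OF that] unfolding r_def positive_def by (metis divide_pos_pos less_irrefl powr_gt_zero)
  have mr: "m \<le> r i" "r i \<le> M" if "i \<in> active" for i
    using that by (auto simp: m_def M_def)
  have m: "m > 0" using active_nonempty rpos by (simp add: m_def)
  obtain i0 where "i0 \<in> active" using active_nonempty by auto
  then have "m \<le> M" using mr[of i0] by simp
  have "m * (v $ i) powr s \<le> (x $ i) powr s \<and> (x $ i) powr s \<le> m * (M / m) * (v $ i) powr s"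
    if "i \<in> active" for i
    using mr[OF that] v_pos[OF that] m by (simp add: r_def field_simps)
  then have "proportional_within s (M / m) x" using m by (auto simp: proportional_within_def)
  moreover have "M / m \<ge> 1" using m \<open>m \<le> M\<close> by simp
  ultimately show ?thesis using that by blast
qed

lemma powr_root_bound:
  fixes a b m s :: real
  assumes "s > 0" "a > 0" "b > 0" "m > 0" "m * a powr s \<le> b powr s"
  shows "m powr (1 / s) * a \<le> b"
proof -
  have "(m * a powr s) powr (1 / s) \<le> (b powr s) powr (1 / s)"
    using assms by (intro powr_mono2) auto
  then show ?thesis using assms by (simp add: powr_mult powr_powr)
qed

text \<open>A vector of norm one cannot dominate another one with a factor above one; the bound on
  \<open>s\<close>-th powers is transferred to the vectors by taking roots.\<close>

lemma sphere_factor_le_1: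
  assumes "s > 0" "positive x" "positive y" "on_sphere x" "on_sphere y" "m > 0"
    "\<And>i. i \<in> active \<Longrightarrow> m * (x $ i) powr s \<le> (y $ i) powr s"
  shows "m \<le> 1"
proof -
  have "m powr (1 / s) \<le> 1"
  proof (rule on_sphere_bound[OF assms(4,5)])
    fix i assume i: "i \<in> active"
    have "x $ i > 0" "y $ i > 0" using i assms(2,3) by (auto simp: positive_def)
    then show "m powr (1 / s) * \<bar>x $ i\<bar> \<le> \<bar>y $ i\<bar>"
      using powr_root_bound[of s "x $ i" "y $ i" m] assms i by simp
  qed simp
  then have "(m powr (1 / s)) powr s \<le> 1 powr s" using assms(1) by (intro powr_mono2) auto
  then show ?thesis using assms by (simp add: powr_powr)
qed

lemma tensor_map_multiple:
  assumes "s > 0" "r > 0"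
  shows "(tensor_map d T (r powr (1 / s) *\<^sub>R v) $ i) powr (s / (p - 1))
       = \<mu> powr (s / (p - 1)) * r powr ((real d - 1) / (p - 1)) * (v $ i) powr s"
proof -
  have "tensor_map d T (r powr (1 / s) *\<^sub>R v) $ i
      = r powr ((real d - 1) / s) * (\<mu> * (v $ i) powr (p - 1))"
    using assms by (simp add: tensor_map_scale v_eigen power_d_powr[unfolded One_nat_def] powr_powr)
  moreover have "\<dots> powr (s / (p - 1))
      = r powr ((real d - 1) / (p - 1)) * (\<mu> powr (s / (p - 1)) * (v $ i) powr s)"
    using assms p_pos \<mu>_pos v_nonneg[of i] by (simp add: powr_mult powr_powr)
  ultimately show ?thesis by (simp add: mult_ac)
qed

text \<open>The factor \<open>(c a + \<sigma>) / (c + \<sigma>)\<close> of the scalar contraction, for \<open>c = \<mu>^(s/(p-1))\<close> and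
  \<open>a = (d-1)/(p-1)\<close>.\<close>

definition rate :: "real \<Rightarrow> real \<Rightarrow> real" where
  "rate s \<sigma> = (\<mu> powr (s / (p - 1)) * ((real d - 1) / (p - 1)) + \<sigma>) / (\<mu> powr (s / (p - 1)) + \<sigma>)"

lemma rate_bounds:
  assumes "\<sigma> \<ge> 0"
  shows "0 \<le> rate s \<sigma>" "rate s \<sigma> < 1"
proof -
  define c where "c = \<mu> powr (s / (p - 1))"
  define a where "a = (real d - 1) / (p - 1)"
  have c: "c > 0" using \<mu>_pos by (simp add: c_def)
  have a: "0 \<le> a" "a < 1" using two_le_d d_less_p by (auto simp: a_def)
  have "c * a < c" using a c by simp
  then show "0 \<le> rate s \<sigma>" "rate s \<sigma> < 1"
    using a c assms by (simp_all add: rate_def c_def[symmetric] a_def[symmetric] add_pos_nonneg)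
qed

text \<open>Sandwiching \<open>x\<close> between two multiples of \<open>v\<close> and applying the monotone map \<open>T\<close> sandwiches the new
  vector between multiples whose quotient the scalar contraction estimates.  The normalization
  of \<open>x\<close> enters only through \<open>m \<le> 1\<close>.\<close>

lemma damped_step_contracts:
  assumes "s > 0" "\<sigma> \<ge> 0" "R \<ge> 1" "positive x" "on_sphere x" "proportional_within s R x" "damped_step s \<sigma> x y"
  shows "proportional_within s (1 + rate s \<sigma> * (R - 1)) y"
proof -
  define c where "c = \<mu> powr (s / (p - 1))"
  define a where "a = (real d - 1) / (p - 1)"
  have c: "c > 0" using \<mu>_pos by (simp add: c_def)
  have a: "0 \<le> a" "a \<le> 1" using two_le_d d_less_p by (auto simp: a_def)
  obtain m where m: "m > 0"
    "\<And>i. i \<in> active \<Longrightarrow> m * (v $ i) powr s \<le> (x $ i) powr s"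
    "\<And>i. i \<in> active \<Longrightarrow> (x $ i) powr s \<le> m * R * (v $ i) powr s"
    using assms(6) by (auto simp: proportional_within_def)
  obtain \<kappa> where \<kappa>: "\<kappa> > 0" "\<And>i. i \<in> active \<Longrightarrow> (y $ i) powr s =
        \<kappa> * ((tensor_map d T x $ i) powr (s / (p - 1)) + \<sigma> * (x $ i) powr s)"
    using assms(7) by (auto simp: damped_step_def)
  have "m \<le> 1"
    using sphere_factor_le_1[OF assms(1) v_positive assms(4) v_sphere assms(5) m(1,2)] .
  have mR: "m * R > 0" using m(1) assms(3) by simp
  have xpos: "x $ i > 0" if "i \<in> active" for i using assms(4) that by (simp add: positive_def)
  have lo: "m powr (1 / s) * v $ i \<le> x $ i" if "i \<in> active" for i
    using powr_root_bound[OF assms(1) v_pos[OF that] xpos[OF that] m(1) m(2)[OF that]] .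
  have hi: "x $ i \<le> (m * R) powr (1 / s) * v $ i" if "i \<in> active" for i
  proof -
    have "((x $ i) powr s) powr (1 / s) \<le> (m * R * (v $ i) powr s) powr (1 / s)"
      using assms(1) m(3)[OF that] by (intro powr_mono2) auto
    then show ?thesis using assms(1) xpos[OF that] v_pos[OF that] mR by (simp add: powr_mult powr_powr)
  qed
  define e where "e = c * m powr a + \<sigma> * m"
  have e: "e > 0" using c m(1) assms(2) by (simp add: e_def add_pos_nonneg)
  have bounds: "\<kappa> * e * (v $ i) powr s \<le> (y $ i) powr s \<and>
      (y $ i) powr s \<le> \<kappa> * e * (1 + rate s \<sigma> * (R - 1)) * (v $ i) powr s" if i: "i \<in> active" for i
  proof
    have q: "s / (p - 1) \<ge> 0" using assms(1) p_pos by simp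
    have Tpos: "tensor_map d T (r *\<^sub>R v) $ i \<ge> 0" if "r > 0" for r
      using i v_pos that by (intro less_imp_le tensor_map_pos) (auto simp: positive_def)
    have Txpos: "tensor_map d T x $ i \<ge> 0"
      using i assms(4) by (intro less_imp_le tensor_map_pos)
    have T_lo: "c * m powr a * (v $ i) powr s \<le> (tensor_map d T x $ i) powr (s / (p - 1))"
    proof -
      have "(tensor_map d T (m powr (1 / s) *\<^sub>R v) $ i) powr (s / (p - 1))
          \<le> (tensor_map d T x $ i) powr (s / (p - 1))"
        using lo v_pos m(1) Tpos q by (intro powr_mono2 tensor_map_mono) (auto simp: less_imp_le)
      then show ?thesis
        using tensor_map_multiple[OF assms(1) m(1)] by (simp add: c_def a_def)
    qed
    have T_hi: "(tensor_map d T x $ i) powr (s / (p - 1)) \<le> c * (m * R) powr a * (v $ i) powr s"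
    proof -
      have "(tensor_map d T x $ i) powr (s / (p - 1))
          \<le> (tensor_map d T ((m * R) powr (1 / s) *\<^sub>R v) $ i) powr (s / (p - 1))"
        using hi xpos Txpos q by (intro powr_mono2 tensor_map_mono) (auto simp: less_imp_le)
      then show ?thesis
        using tensor_map_multiple[OF assms(1) mR] by (simp add: c_def a_def)
    qed
    have "e * (v $ i) powr s = c * m powr a * (v $ i) powr s + \<sigma> * (m * (v $ i) powr s)"
      by (simp add: e_def algebra_simps)
    also have "\<dots> \<le> (tensor_map d T x $ i) powr (s / (p - 1)) + \<sigma> * (x $ i) powr s"
      using T_lo m(2)[OF i] assms(2) by (intro add_mono mult_left_mono) auto
    finally show "\<kappa> * e * (v $ i) powr s \<le> (y $ i) powr s"
      using \<kappa>(1) by (simp add: \<kappa>(2)[OF i] mult.assoc)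
    have "(tensor_map d T x $ i) powr (s / (p - 1)) + \<sigma> * (x $ i) powr s
        \<le> c * (m * R) powr a * (v $ i) powr s + \<sigma> * (m * R * (v $ i) powr s)"
      using T_hi m(3)[OF i] assms(2) by (intro add_mono mult_left_mono) auto
    also have "\<dots> = (c * (m * R) powr a + \<sigma> * (m * R)) * (v $ i) powr s"
      by (simp add: algebra_simps)
    also have "\<dots> \<le> e * (1 + rate s \<sigma> * (R - 1)) * (v $ i) powr s"
      using damped_contraction[OF c assms(2) a m(1) \<open>m \<le> 1\<close> assms(3)]
      by (intro mult_right_mono) (auto simp: e_def rate_def c_def a_def)
    finally show "(y $ i) powr s \<le> \<kappa> * e * (1 + rate s \<sigma> * (R - 1)) * (v $ i) powr s"
      using \<kappa>(1) by (simp add: \<kappa>(2)[OF i] mult.assoc)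
  qed
  moreover have "\<kappa> * e > 0" using \<kappa>(1) e by simp
  ultimately show ?thesis unfolding proportional_within_def by blast
qed

text \<open>Normalization fixes the unknown factor \<open>m\<close> up to \<open>R\<close>: comparing the norms in both directions
  gives \<open>m \<le> 1 \<le> m R\<close>.\<close>

lemma proportional_imp_bounds:
  assumes "s > 0" "R \<ge> 1" "positive x" "on_sphere x" "proportional_within s R x" "i \<in> active"
  shows "(v $ i) powr s / R \<le> (x $ i) powr s \<and> (x $ i) powr s \<le> R * (v $ i) powr s"
proof -
  obtain m where m: "m > 0"
    "\<And>i. i \<in> active \<Longrightarrow> m * (v $ i) powr s \<le> (x $ i) powr s"
    "\<And>i. i \<in> active \<Longrightarrow> (x $ i) powr s \<le> m * R * (v $ i) powr s"
    using assms(5) by (auto simp: proportional_within_def)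
  have m1: "m \<le> 1"
    using sphere_factor_le_1[OF assms(1) v_positive assms(3) v_sphere assms(4) m(1,2)] .
  have mR: "m * R > 0" using m(1) assms(2) by simp
  have "1 / (m * R) \<le> 1"
    using mR m(3)
    by (intro sphere_factor_le_1[OF assms(1) assms(3) v_positive assms(4) v_sphere])
      (auto simp: field_simps)
  then have "1 / R \<le> m" using m(1) assms(2) by (simp add: field_simps)
  have "(v $ i) powr s / R \<le> m * (v $ i) powr s"
    using mult_right_mono[OF \<open>1 / R \<le> m\<close>, of "(v $ i) powr s"] by simp
  moreover have "m * R * (v $ i) powr s \<le> 1 * R * (v $ i) powr s"
    using m1 assms(2) by (intro mult_right_mono) auto
  ultimately show ?thesis using m(2,3)[OF assms(6)] by simp
qed

text \<open>The spread \<open>R - 1\<close> decays geometrically, so the iterates are squeezed onto \<open>v\<close>.  The starting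
  vector is neither normalized nor zero outside the active set; the estimates begin at the
  first iterate.\<close>

theorem damped_iteration_converges:
  assumes "s > 0" "\<sigma> \<ge> 0" "positive (X 0)" "\<And>k. positive (X k) \<Longrightarrow> damped_step s \<sigma> (X k) (X (Suc k))"
  shows "(\<lambda>k. rayleigh d T p (X (Suc k))) \<longlonglongrightarrow> lp_spectral_radius d T p"
proof -
  have pos: "positive (X k)" for k
    by (induction k) (use assms in \<open>auto simp: damped_step_def\<close>)
  have step: "damped_step s \<sigma> (X k) (X (Suc k))" for k using assms(4) pos by blast
  have sph: "on_sphere (X (Suc k))" for k using step by (simp add: damped_step_def)
  obtain R where R: "R \<ge> 1" "proportional_within s R (X (Suc 0))" using proportional_within_exists pos by blast
  define \<rho> where "\<rho> = rate s \<sigma>"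
  have \<rho>: "0 \<le> \<rho>" "\<rho> < 1" using rate_bounds[OF assms(2)] by (auto simp: \<rho>_def)
  define Q where "Q k = 1 + \<rho> ^ k * (R - 1)" for k
  have Q1: "Q k \<ge> 1" for k using R \<rho> by (simp add: Q_def)
  have close: "proportional_within s (Q k) (X (Suc k))" for k
  proof (induction k)
    case (Suc k)
    have "proportional_within s (1 + \<rho> * (Q k - 1)) (X (Suc (Suc k)))"
      unfolding \<rho>_def using damped_step_contracts[OF assms(1,2) Q1 pos sph Suc.IH step] .
    then show ?case by (simp add: Q_def mult.assoc)
  qed (simp add: Q_def R)
  have Q: "Q \<longlonglongrightarrow> 1"
  proof -
    have "(\<lambda>k. 1 + \<rho> ^ k * (R - 1)) \<longlonglongrightarrow> 1 + 0 * (R - 1)"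
      using \<rho> by (intro tendsto_intros LIMSEQ_power_zero) auto
    then show ?thesis by (simp add: Q_def[abs_def])
  qed
  have "(\<lambda>k. X (Suc k)) \<longlonglongrightarrow> v"
  proof (rule vec_tendstoI)
    fix i
    show "(\<lambda>k. X (Suc k) $ i) \<longlonglongrightarrow> v $ i"
    proof (cases "i \<in> active")
      case True
      have bounds: "(v $ i) powr s / Q k \<le> (X (Suc k) $ i) powr s"
          "(X (Suc k) $ i) powr s \<le> Q k * (v $ i) powr s" for k
        using proportional_imp_bounds[OF assms(1) Q1 pos sph close True] by auto
      have "(\<lambda>k. (X (Suc k) $ i) powr s) \<longlonglongrightarrow> (v $ i) powr s"
      proof (rule tendsto_sandwich)
        show "(\<lambda>k. (v $ i) powr s / Q k) \<longlonglongrightarrow> (v $ i) powr s"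
          using tendsto_divide[OF tendsto_const Q, of "(v $ i) powr s"] by simp
        show "(\<lambda>k. Q k * (v $ i) powr s) \<longlonglongrightarrow> (v $ i) powr s"
          using tendsto_mult_right[OF Q, of "(v $ i) powr s"] by simp
      qed (auto simp: bounds)
      then have "(\<lambda>k. ((X (Suc k) $ i) powr s) powr (1 / s)) \<longlonglongrightarrow> ((v $ i) powr s) powr (1 / s)"
        by (rule tendsto_powr[OF _ tendsto_const]) (use v_pos[OF True] in simp)
      moreover have "((y $ i) powr s) powr (1 / s) = y $ i" if "positive y" for y :: "real^'n"
        using that True assms(1) by (simp add: powr_powr positive_def less_imp_le)
      ultimately show ?thesis by (simp only: pos v_positive)
    next
      case False
      then show ?thesis using sph v_zero by (simp add: on_sphere_def)
    qed
  qed
  then show ?thesis unfolding spectral_radius_eq by (rule rayleigh_tendsto) (rule sph)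
qed

section \<open>Both algorithms are damped steps\<close>

lemma damped_step_normalize:
  assumes "s > 0" "\<sigma> \<ge> 0" "positive x"
    "\<And>i. i \<in> active \<Longrightarrow> y $ i > 0" "\<And>i. i \<notin> active \<Longrightarrow> y $ i = 0"
    "\<And>i. i \<in> active \<Longrightarrow> (y $ i) powr s =
        (tensor_map d T x $ i) powr (s / (p - 1)) + \<sigma> * (x $ i) powr s"
  shows "damped_step s \<sigma> x (lp_normalize p y)"
proof -
  obtain i0 where i0: "i0 \<in> active" using active_nonempty by auto
  have y0: "y $ i0 \<noteq> 0" using assms(4)[OF i0] by simp
  define N where "N = lp_norm p y"
  have N: "N > 0" using lp_norm_pos[OF y0] by (simp add: N_def)
  have comp: "lp_normalize p y $ i = inverse N * y $ i" for i by (simp add: lp_normalize_def N_def)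
  show ?thesis
    unfolding damped_step_def
  proof (intro conjI exI[of _ "inverse N powr s"] ballI)
    show "positive (lp_normalize p y)" using assms(4) N by (simp add: positive_def comp)
    show "on_sphere (lp_normalize p y)"
      using assms(5) lp_norm_normalize[of p y i0, OF _ y0] p_pos by (simp add: on_sphere_def comp)
    show "inverse N powr s > 0" using N by simp
    fix i assume i: "i \<in> active"
    show "(lp_normalize p y $ i) powr s = inverse N powr s *
        ((tensor_map d T x $ i) powr (s / (p - 1)) + \<sigma> * (x $ i) powr s)"
      using N assms(4)[OF i] unfolding comp by (simp add: powr_mult assms(6)[OF i, symmetric])
  qed
qed

lemma conjugate_exponent: "p / (p - 1) - 1 = 1 / (p - 1)"
  using p_pos by (simp add: field_simps)

text \<open>The entrywise sign in both algorithms is one on active coordinates and zero elsewhere, so the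
  damping term does not keep the inactive coordinates of \<open>x\<close> alive.\<close>

lemma alg1_damped_step:
  assumes "\<sigma> \<ge> 0" "positive x"
  shows "damped_step 1 \<sigma> x (alg1_step d T p \<sigma> x)"
  unfolding alg1_step_def Let_def
proof (rule damped_step_normalize)
  let ?z = "tensor_map d T x"
  let ?y = "duality_map (p / (p - 1)) ?z + \<sigma> *\<^sub>R (entrywise_sign ?z * x)"
  fix i
  {
    assume i: "i \<in> active"
    have z: "?z $ i > 0" using tensor_map_pos assms i by blast
    have x: "x $ i > 0" using assms i by (simp add: positive_def)
    have y: "?y $ i = (?z $ i) powr (1 / (p - 1)) + \<sigma> * x $ i"
      using z by (simp add: duality_map_def entrywise_sign_def conjugate_exponent)
    show "?y $ i > 0" unfolding y using z x assms(1) by (simp add: add_pos_nonneg)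
    then show "(?y $ i) powr 1 = (?z $ i) powr (1 / (p - 1)) + \<sigma> * (x $ i) powr 1"
      using x y by simp
  }
  assume "i \<notin> active"
  then show "?y $ i = 0" by (simp add: duality_map_def entrywise_sign_def tensor_map_inactive)
qed (use assms in auto)

lemma alg2_damped_step:
  assumes "\<sigma> \<ge> 0" "positive x"
  shows "damped_step (p - 1) \<sigma> x (alg2_step d T p \<sigma> x)"
  unfolding alg2_step_def Let_def
proof (rule damped_step_normalize)
  let ?z = "tensor_map d T x"
  let ?w = "?z + \<sigma> *\<^sub>R (entrywise_sign ?z * duality_map p x)"
  let ?y = "duality_map (p / (p - 1)) ?w"
  fix i
  {
    assume i: "i \<in> active"
    have z: "?z $ i > 0" using tensor_map_pos assms i by blast
    have x: "x $ i > 0" using assms i by (simp add: positive_def)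
    have w: "?w $ i = ?z $ i + \<sigma> * (x $ i) powr (p - 1)"
      using z x by (simp add: duality_map_def entrywise_sign_def)
    have w_pos: "?w $ i > 0" unfolding w using z x assms(1) by (simp add: add_pos_nonneg)
    then have y: "?y $ i = (?w $ i) powr (1 / (p - 1))"
      unfolding duality_map_def[of "p / (p - 1)"] conjugate_exponent by simp
    show "?y $ i > 0" unfolding y using w_pos by simp
    show "(?y $ i) powr (p - 1) = (?z $ i) powr ((p - 1) / (p - 1)) + \<sigma> * (x $ i) powr (p - 1)"
      unfolding y using w_pos z p_pos w by (simp add: powr_powr)
  }
  assume "i \<notin> active"
  then show "?y $ i = 0" by (simp add: duality_map_def entrywise_sign_def tensor_map_inactive)
qed (use assms p_pos in auto)

end

theorem corollary1:
  fixes T :: "('n::finite) tensor" and d :: nat and p \<sigma> :: real and x0 :: "real^'n"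
  assumes "d \<ge> 2"
    and "tensor_nonzero d T"
    and "tensor_nonneg d T"
    and "tensor_symmetric d T"
    and "p > real d"
    and "\<sigma> \<ge> 0"
    and "\<And>i. x0 $ i > 0"
  shows "(\<lambda>k. rayleigh d T p (alg1_iterate d T p \<sigma> x0 (Suc k)))
           \<longlonglongrightarrow> lp_spectral_radius d T p
       \<and> (\<lambda>k. rayleigh d T p (alg2_iterate d T p \<sigma> x0 (Suc k)))
           \<longlonglongrightarrow> lp_spectral_radius d T p"
proof -
  interpret nonneg_symmetric_tensor T d p using assms by unfold_locales
  obtain v \<mu> where v: "positive v" "on_sphere v" "\<mu> > 0"
    "\<And>i. tensor_map d T v $ i = \<mu> * (v $ i) powr (p - 1)"
    using Perron_eigenpair_exists by blast
  interpret Perron_eigenpair T d p v \<mu> using v by unfold_locales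
  have x0: "positive x0" using assms(7) by (simp add: positive_def)
  show ?thesis
  proof
    show "(\<lambda>k. rayleigh d T p (alg1_iterate d T p \<sigma> x0 (Suc k))) \<longlonglongrightarrow> lp_spectral_radius d T p"
      by (rule damped_iteration_converges[of 1 \<sigma>])
        (use assms(6) x0 alg1_damped_step in \<open>auto simp: alg1_iterate_def\<close>)
    show "(\<lambda>k. rayleigh d T p (alg2_iterate d T p \<sigma> x0 (Suc k))) \<longlonglongrightarrow> lp_spectral_radius d T p"
      by (rule damped_iteration_converges[of "p - 1" \<sigma>])
        (use assms(6) x0 alg2_damped_step p_pos in \<open>auto simp: alg2_iterate_def\<close>)
  qed
qed

end
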